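(* For every finite sequence of c.e. Turing degrees $\mathbf a_1,\mathbf a_2,\dots,\mathbf a_k$ ($k\ge 1$) there is a pair of c.e. sets $U\subseteq V$ such that for every Turing degree $\mathbf x$: there exists an $\mathbf x$-computable set $X$ with $U\subseteq X\subseteq V$ if and only if $$\mathbf a_1\le\mathbf x\ \text{ or }\ \mathbf a_2\le\mathbf x\ \text{ or }\ \dots\ \text{ or }\ \mathbf a_k\le\mathbf x.$$
   Context: All sets are subsets of $\omega$. A c.e. degree is a Turing degree containing a c.e. set. *)

theory Defs
  imports Main
begin

text \<open>Kleene's schemes for the partial recursive functions relative to an oracle. Programs carry
  no fixed arity; on argument lists of unsuitable shape they are undefined.\<close>

datatype recf =
    Zero
  | Succ
  | Proj nat
  | Oracle
  | Comp recf "recf list"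
  | PrimRec recf recf
  | Mu recf

text \<open>\<open>eval B p xs y\<close>: the program \<open>p\<close> with oracle \<open>B\<close> halts on the arguments \<open>xs\<close> with output \<open>y\<close>.
  The recursion variable and the search variable come first in the argument list.\<close>

inductive eval :: "nat set \<Rightarrow> recf \<Rightarrow> nat list \<Rightarrow> nat \<Rightarrow> bool" for B :: "nat set" where
  eval_Zero: "eval B Zero xs 0"
| eval_Succ: "eval B Succ [x] (Suc x)"
| eval_Proj: "i < length xs \<Longrightarrow> eval B (Proj i) xs (xs ! i)"
| eval_Oracle: "eval B Oracle [x] (of_bool (x \<in> B))"
| eval_Comp:
    "list_all2 (\<lambda>g y. eval B g xs y) gs ys \<Longrightarrow> eval B f ys z \<Longrightarrow> eval B (Comp f gs) xs z"
| eval_PrimRec_0: "eval B f xs y \<Longrightarrow> eval B (PrimRec f g) (0 # xs) y"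
| eval_PrimRec_Suc:
    "eval B (PrimRec f g) (n # xs) y \<Longrightarrow> eval B g (n # y # xs) z \<Longrightarrow>
     eval B (PrimRec f g) (Suc n # xs) z"
| eval_Mu:
    "eval B f (n # xs) 0 \<Longrightarrow> \<forall>m<n. \<exists>y. eval B f (m # xs) (Suc y) \<Longrightarrow> eval B (Mu f) xs n"

inductive_cases eval_ZeroE: "eval B Zero xs y"
inductive_cases eval_SuccE: "eval B Succ xs y"
inductive_cases eval_ProjE: "eval B (Proj i) xs y"
inductive_cases eval_OracleE: "eval B Oracle xs y"
inductive_cases eval_CompE: "eval B (Comp f gs) xs y"
inductive_cases eval_PrimRec_0E: "eval B (PrimRec f g) (0 # xs) y"
inductive_cases eval_PrimRec_SucE: "eval B (PrimRec f g) (Suc n # xs) y"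
inductive_cases eval_MuE: "eval B (Mu f) xs y"

lemma eval_deterministic: "eval B p xs y \<Longrightarrow> eval B p xs z \<Longrightarrow> y = z"
proof (induction arbitrary: z rule: eval.induct)
  case (eval_Zero xs)
  then show ?case by (rule eval_ZeroE) simp
next
  case (eval_Succ x)
  then show ?case by (rule eval_SuccE) simp
next
  case (eval_Proj i xs)
  from eval_Proj.prems show ?case by (rule eval_ProjE) simp
next
  case (eval_Oracle x)
  then show ?case by (rule eval_OracleE) simp
next
  case (eval_Comp xs gs ys f u)
  from eval_Comp.prems obtain ys' where
    ys': "list_all2 (\<lambda>g y. eval B g xs y) gs ys'" and z: "eval B f ys' z"
    by (rule eval_CompE) (rule that)
  have "ys = ys'"
  proof (rule nth_equalityI)
    show "length ys = length ys'"
      using list_all2_lengthD[OF eval_Comp.IH(1)] list_all2_lengthD[OF ys'] by (rule subst)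
    show "ys ! i = ys' ! i" if "i < length ys" for i
    proof -
      from that list_all2_lengthD[OF eval_Comp.IH(1)] have "i < length gs" by simp
      from list_all2_nthD[OF eval_Comp.IH(1) this, THEN conjunct2] list_all2_nthD[OF ys' this]
      show ?thesis by (elim allE impE)
    qed
  qed
  with z have "eval B f ys z" by simp
  then show ?case by (rule eval_Comp.IH(2))
next
  case (eval_PrimRec_0 f xs y g)
  from eval_PrimRec_0.prems have "eval B f xs z" by (rule eval_PrimRec_0E)
  then show ?case by (rule eval_PrimRec_0.IH)
next
  case (eval_PrimRec_Suc f g n xs y u)
  from eval_PrimRec_Suc.prems obtain y' where
    y': "eval B (PrimRec f g) (n # xs) y'" and z: "eval B g (n # y' # xs) z"
    by (rule eval_PrimRec_SucE) (rule that)
  from z have "eval B g (n # y # xs) z" unfolding eval_PrimRec_Suc.IH(1)[OF y'] .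
  then show ?case by (rule eval_PrimRec_Suc.IH(2))
next
  case (eval_Mu f n xs)
  from eval_Mu.prems
  have z: "eval B f (z # xs) 0 \<and> (\<forall>m<z. \<exists>y. eval B f (m # xs) (Suc y))"
    by (rule eval_MuE) (intro conjI)
  have "\<not> n < z"
  proof
    assume "n < z"
    with z obtain y where "eval B f (n # xs) (Suc y)" by blast
    from eval_Mu.IH(1)[OF this] show False by (rule nat.distinct(1)[THEN notE])
  qed
  moreover have "\<not> z < n"
  proof
    assume "z < n"
    with eval_Mu.IH(2) obtain y where "\<forall>v. eval B f (z # xs) v \<longrightarrow> Suc y = v" by blast
    with z have "Suc y = 0" by blast
    then show False by simp
  qed
  ultimately show ?case by simp
qed

definition computable_in :: "nat set \<Rightarrow> (nat \<Rightarrow> nat) \<Rightarrow> bool" where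
  "computable_in B f \<longleftrightarrow> (\<exists>p. \<forall>n. eval B p [n] (f n))"

text \<open>The empty oracle answers every query with 0, so it provides nothing beyond \<open>Zero\<close>.\<close>

abbreviation computable :: "(nat \<Rightarrow> nat) \<Rightarrow> bool" where
  "computable \<equiv> computable_in {}"

definition turing_reducible :: "nat set \<Rightarrow> nat set \<Rightarrow> bool" (infix "\<le>\<^sub>T" 50) where
  "A \<le>\<^sub>T B \<longleftrightarrow> computable_in B (\<lambda>n. of_bool (n \<in> A))"

definition turing_equiv :: "nat set \<Rightarrow> nat set \<Rightarrow> bool" (infix "\<equiv>\<^sub>T" 50) where
  "A \<equiv>\<^sub>T B \<longleftrightarrow> A \<le>\<^sub>T B \<and> B \<le>\<^sub>T A"

definition ce :: "nat set \<Rightarrow> bool" where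
  "ce A \<longleftrightarrow> A = {} \<or> (\<exists>f. computable f \<and> A = range f)"

lemma turing_reducible_refl: "A \<le>\<^sub>T A"
  unfolding turing_reducible_def computable_in_def
  by (intro exI[of _ Oracle] allI eval_Oracle)

text \<open>\<open>subst_oracle q p\<close> answers the oracle queries of \<open>p\<close> by running \<open>q\<close>.\<close>

primrec subst_oracle :: "recf \<Rightarrow> recf \<Rightarrow> recf" where
  "subst_oracle q Zero = Zero"
| "subst_oracle q Succ = Succ"
| "subst_oracle q (Proj i) = Proj i"
| "subst_oracle q Oracle = q"
| "subst_oracle q (Comp f gs) = Comp (subst_oracle q f) (map (subst_oracle q) gs)"
| "subst_oracle q (PrimRec f g) = PrimRec (subst_oracle q f) (subst_oracle q g)"
| "subst_oracle q (Mu f) = Mu (subst_oracle q f)"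

lemma eval_subst_oracle:
  assumes q: "\<And>n. eval C q [n] (of_bool (n \<in> B))"
  shows "eval B p xs y \<Longrightarrow> eval C (subst_oracle q p) xs y"
proof (induction rule: eval.induct)
  case (eval_Comp xs gs ys f z)
  have "list_all2 (\<lambda>g y. eval C g xs y) (map (subst_oracle q) gs) ys"
    unfolding list_all2_map1 using eval_Comp.IH(1) by (rule list_all2_mono) simp
  from eval.eval_Comp[OF this eval_Comp.IH(2)] show ?case by simp
next
  case (eval_Mu f n xs)
  have "\<forall>m<n. \<exists>y. eval C (subst_oracle q f) (m # xs) (Suc y)"
    using eval_Mu.IH(2) by blast
  from eval.eval_Mu[OF eval_Mu.IH(1) this] show ?case by simp
qed (simp_all add: q eval.intros(1-3,6) eval.eval_PrimRec_Suc)

lemma turing_reducible_trans: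
  assumes "A \<le>\<^sub>T B" and "B \<le>\<^sub>T C"
  shows "A \<le>\<^sub>T C"
proof -
  from assms obtain p q where
    p: "\<And>n. eval B p [n] (of_bool (n \<in> A))" and q: "\<And>n. eval C q [n] (of_bool (n \<in> B))"
    unfolding turing_reducible_def computable_in_def by auto
  have "eval C (subst_oracle q p) [n] (of_bool (n \<in> A))" for n
    using q p by (rule eval_subst_oracle)
  then show ?thesis
    unfolding turing_reducible_def computable_in_def by (intro exI allI)
qed

lemma equivp_turing_equiv: "equivp turing_equiv"
proof (intro equivpI reflpI sympI transpI)
  show "A \<equiv>\<^sub>T A" for A
    by (simp add: turing_equiv_def turing_reducible_refl)
  show "A \<equiv>\<^sub>T B \<Longrightarrow> B \<equiv>\<^sub>T A" for A B
    by (simp add: turing_equiv_def)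
  show "A \<equiv>\<^sub>T B \<Longrightarrow> B \<equiv>\<^sub>T C \<Longrightarrow> A \<equiv>\<^sub>T C" for A B C
    unfolding turing_equiv_def by (metis turing_reducible_trans)
qed

quotient_type turing_degree = "nat set" / turing_equiv
  morphisms rep_degree degree_of
  by (rule equivp_turing_equiv)

instantiation turing_degree :: order
begin

lift_definition less_eq_turing_degree :: "turing_degree \<Rightarrow> turing_degree \<Rightarrow> bool"
  is turing_reducible
  unfolding turing_equiv_def by (metis turing_reducible_trans)

definition less_turing_degree :: "turing_degree \<Rightarrow> turing_degree \<Rightarrow> bool" where
  "less_turing_degree a b \<longleftrightarrow> a \<le> b \<and> \<not> b \<le> a"

instance
proof
  fix a b c :: turing_degree
  show "a < b \<longleftrightarrow> a \<le> b \<and> \<not> b \<le> a" by (rule less_turing_degree_def)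
  show "a \<le> a" by transfer (rule turing_reducible_refl)
  show "a \<le> b \<Longrightarrow> b \<le> c \<Longrightarrow> a \<le> c" by transfer (rule turing_reducible_trans)
  show "a \<le> b \<Longrightarrow> b \<le> a \<Longrightarrow> a = b" by transfer (simp add: turing_equiv_def)
qed

end

definition ce_degree :: "turing_degree \<Rightarrow> bool" where
  "ce_degree a \<longleftrightarrow> (\<exists>A. ce A \<and> degree_of A = a)"

definition degree_computable :: "turing_degree \<Rightarrow> nat set \<Rightarrow> bool" where
  "degree_computable x X \<longleftrightarrow> (\<exists>B. degree_of B = x \<and> X \<le>\<^sub>T B)"

end

theory Submission
  imports Defs "HOL-Library.Nat_Bijection"
begin

text \<open>For a single c.e. set \<open>A\<close> take \<open>U = V = A\<close>. Given c.e. sets \<open>U \<subseteq> V\<close> and a further c.e. set \<open>A\<close>,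
  consider on pairs the interval between \<open>A \<times> U\<close> and \<open>{(a, u). a \<in> A \<or> u \<in> V}\<close>. It contains
  \<open>{(a, u). a \<in> A}\<close> and, for every \<open>X\<close> between \<open>U\<close> and \<open>V\<close>, the set \<open>{(a, u). u \<in> X}\<close>. Conversely let
  \<open>X\<close> lie in the interval. If every \<open>a \<notin> A\<close> has some \<open>u \<in> U\<close> with \<open>(a, u) \<notin> X\<close>, then the complement of
  \<open>A\<close> is c.e. in \<open>X\<close>, so \<open>A\<close> is computable from \<open>X\<close>. Otherwise some \<open>a \<notin> A\<close> has the property that the
  section of \<open>X\<close> at \<open>a\<close> lies between \<open>U\<close> and \<open>V\<close>.\<close>

section \<open>Closure properties of computable functions\<close>

text \<open>Programs carry no arity, so \<open>k\<close> fixes one here: only the values of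
  \<open>F\<close> on lists of length \<open>k\<close> matter, and on these the program must
  halt.\<close>

definition computable_fun :: "nat set \<Rightarrow> nat \<Rightarrow> (nat list \<Rightarrow> nat) \<Rightarrow> bool" where
  "computable_fun B k F \<longleftrightarrow> (\<exists>p. \<forall>xs. length xs = k \<longrightarrow> eval B p xs (F xs))"

lemma computable_funI: "(\<And>xs. length xs = k \<Longrightarrow> eval B p xs (F xs)) \<Longrightarrow> computable_fun B k F"
  unfolding computable_fun_def by blast

lemma computable_fun_cong:
  assumes "computable_fun B k F" and "\<And>xs. length xs = k \<Longrightarrow> F xs = G xs"
  shows "computable_fun B k G"
  using assms unfolding computable_fun_def by auto

lemma computable_in_iff: "computable_in B f \<longleftrightarrow> computable_fun B 1 (\<lambda>xs. f (xs ! 0))"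
  unfolding computable_in_def computable_fun_def
  by (metis One_nat_def length_0_conv length_Suc_conv nth_Cons_0)

lemma computable_fun_nth: "i < k \<Longrightarrow> computable_fun B k (\<lambda>xs. xs ! i)"
  by (rule computable_funI[where p = "Proj i"]) (simp add: eval_Proj)

lemma computable_fun_zero: "computable_fun B k (\<lambda>xs. 0)"
  by (rule computable_funI[where p = Zero]) (rule eval_Zero)

lemma computable_fun_comp:
  assumes F: "computable_fun B (length Gs) F" and Gs: "\<And>G. G \<in> set Gs \<Longrightarrow> computable_fun B k G"
  shows "computable_fun B k (\<lambda>xs. F (map (\<lambda>G. G xs) Gs))"
proof -
  obtain p where p: "\<And>xs. length xs = length Gs \<Longrightarrow> eval B p xs (F xs)"
    using F unfolding computable_fun_def by blast
  obtain q where q: "\<And>G xs. G \<in> set Gs \<Longrightarrow> length xs = k \<Longrightarrow> eval B (q G) xs (G xs)"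
    using Gs unfolding computable_fun_def by metis
  show ?thesis
  proof (rule computable_funI)
    fix xs :: "nat list"
    assume "length xs = k"
    then have "list_all2 (\<lambda>g y. eval B g xs y) (map q Gs) (map (\<lambda>G. G xs) Gs)"
      by (auto simp: list_all2_conv_all_nth q)
    then show "eval B (Comp p (map q Gs)) xs (F (map (\<lambda>G. G xs) Gs))"
      by (rule eval_Comp) (simp add: p)
  qed
qed

lemma computable_fun_comp1:
  assumes "computable_fun B 1 (\<lambda>xs. f (xs ! 0))" and "computable_fun B k G"
  shows "computable_fun B k (\<lambda>xs. f (G xs))"
  using computable_fun_comp[of B "[G]" "\<lambda>xs. f (xs ! 0)" k] assms by simp

lemma computable_fun_app:
  assumes "computable_in B f" and "computable_fun B k G"
  shows "computable_fun B k (\<lambda>xs. f (G xs))"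
  using assms(1)[unfolded computable_in_iff] assms(2) by (rule computable_fun_comp1)

lemma computable_fun_comp2:
  assumes "computable_fun B 2 (\<lambda>xs. f (xs ! 0) (xs ! 1))"
    and "computable_fun B k G" and "computable_fun B k H"
  shows "computable_fun B k (\<lambda>xs. f (G xs) (H xs))"
  using computable_fun_comp[of B "[G, H]" "\<lambda>xs. f (xs ! 0) (xs ! 1)" k] assms
  by (auto simp: numeral_2_eq_2)

lemma computable_fun_comp3:
  assumes "computable_fun B 3 (\<lambda>xs. f (xs ! 0) (xs ! 1) (xs ! 2))"
    and "computable_fun B k G" and "computable_fun B k H" and "computable_fun B k I"
  shows "computable_fun B k (\<lambda>xs. f (G xs) (H xs) (I xs))"
  using computable_fun_comp[of B "[G, H, I]" "\<lambda>xs. f (xs ! 0) (xs ! 1) (xs ! 2)" k] assms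
  by (auto simp: numeral_3_eq_3)

lemma computable_fun_Suc:
  assumes "computable_fun B k F"
  shows "computable_fun B k (\<lambda>xs. Suc (F xs))"
proof (rule computable_fun_comp1[OF _ assms])
  show "computable_fun B 1 (\<lambda>xs. Suc (xs ! 0))"
    by (rule computable_funI[where p = Succ]) (auto simp: length_Suc_conv eval_Succ)
qed

lemma computable_fun_const: "computable_fun B k (\<lambda>xs. c)"
  by (induction c) (simp_all add: computable_fun_zero computable_fun_Suc)

lemma computable_fun_rec:
  assumes F: "computable_fun B k F" and G: "computable_fun B (Suc (Suc k)) G"
  shows "computable_fun B (Suc k) (\<lambda>xs. rec_nat (F (tl xs)) (\<lambda>n y. G (n # y # tl xs)) (xs ! 0))"
proof -
  obtain p where p: "\<And>xs. length xs = k \<Longrightarrow> eval B p xs (F xs)"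
    using F unfolding computable_fun_def by blast
  obtain q where q: "\<And>xs. length xs = Suc (Suc k) \<Longrightarrow> eval B q xs (G xs)"
    using G unfolding computable_fun_def by blast
  have "eval B (PrimRec p q) (n # ys) (rec_nat (F ys) (\<lambda>n y. G (n # y # ys)) n)"
    if "length ys = k" for n ys
  proof (induction n)
    case 0
    show ?case using that by (simp add: eval_PrimRec_0 p)
  next
    case (Suc n)
    show ?case using eval_PrimRec_Suc[OF Suc q] that by simp
  qed
  then show ?thesis
    by (intro computable_funI[where p = "PrimRec p q"]) (auto simp: length_Suc_conv)
qed

text \<open>Unbounded search stays total: \<open>ex\<close> provides a zero, and totality of
  \<open>F\<close> supplies the successor values that \<open>eval_Mu\<close> demands below the least
  one.\<close>

lemma computable_fun_Least:
  assumes F: "computable_fun B (Suc k) F" and ex: "\<And>xs. length xs = k \<Longrightarrow> \<exists>n. F (n # xs) = 0"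
  shows "computable_fun B k (\<lambda>xs. LEAST n. F (n # xs) = 0)"
proof -
  obtain p where p: "\<And>xs. length xs = Suc k \<Longrightarrow> eval B p xs (F xs)"
    using F unfolding computable_fun_def by blast
  show ?thesis
  proof (rule computable_funI)
    fix xs :: "nat list"
    assume len: "length xs = k"
    let ?n = "LEAST n. F (n # xs) = 0"
    have eq: "eval B p (m # xs) (F (m # xs))" for m
      by (rule p) (simp add: len)
    have "F (?n # xs) = 0"
      using ex[OF len] by (rule LeastI_ex)
    with eq[of ?n] have "eval B p (?n # xs) 0" by simp
    moreover have "\<exists>y. eval B p (m # xs) (Suc y)" if "m < ?n" for m
      using eq[of m] not_less_Least[OF that] not0_implies_Suc by metis
    ultimately show "eval B (Mu p) xs ?n"
      by (blast intro: eval_Mu)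
  qed
qed

section \<open>Arithmetic and definition by cases\<close>

lemma computable_fun_add:
  assumes "computable_fun B k F" and "computable_fun B k G"
  shows "computable_fun B k (\<lambda>xs. F xs + G xs)"
proof (rule computable_fun_comp2[OF _ assms])
  have "computable_fun B (Suc (Suc 0))
      (\<lambda>xs. rec_nat (tl xs ! 0) (\<lambda>n y. Suc ((n # y # tl xs) ! 1)) (xs ! 0))"
    by (intro computable_fun_rec computable_fun_Suc computable_fun_nth) simp_all
  moreover have "rec_nat b (\<lambda>n. Suc) a = a + b" for a b
    by (induction a) simp_all
  ultimately have "computable_fun B (Suc (Suc 0)) (\<lambda>xs. xs ! 0 + tl xs ! 0)" by simp
  then show "computable_fun B 2 (\<lambda>xs. xs ! 0 + xs ! 1)"
    unfolding numeral_2_eq_2 by (rule computable_fun_cong) (auto simp: length_Suc_conv)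
qed

lemma computable_fun_pred:
  assumes "computable_fun B k F"
  shows "computable_fun B k (\<lambda>xs. F xs - 1)"
proof (rule computable_fun_comp1[OF _ assms])
  have "computable_fun B (Suc 0) (\<lambda>xs. rec_nat 0 (\<lambda>n y. (n # y # tl xs) ! 0) (xs ! 0))"
    by (intro computable_fun_rec computable_fun_zero computable_fun_nth) simp_all
  moreover have "rec_nat 0 (\<lambda>n y. n) a = a - 1" for a
    by (cases a) simp_all
  ultimately show "computable_fun B 1 (\<lambda>xs. xs ! 0 - 1)" by simp
qed

lemma computable_fun_diff:
  assumes "computable_fun B k F" and "computable_fun B k G"
  shows "computable_fun B k (\<lambda>xs. F xs - G xs)"
\<comment> \<open>The arguments are swapped because the recursion runs on the subtrahend, and the
  recursion variable comes first.\<close>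
proof (rule computable_fun_comp2[OF _ assms(2,1)])
  have "computable_fun B (Suc (Suc 0))
      (\<lambda>xs. rec_nat (tl xs ! 0) (\<lambda>n y. (n # y # tl xs) ! 1 - 1) (xs ! 0))"
    by (intro computable_fun_rec computable_fun_pred computable_fun_nth) simp_all
  moreover have "rec_nat b (\<lambda>n y. y - Suc 0) a = b - a" for a b
    by (induction a) simp_all
  ultimately have "computable_fun B (Suc (Suc 0)) (\<lambda>xs. tl xs ! 0 - xs ! 0)" by simp
  then show "computable_fun B 2 (\<lambda>xs. xs ! 1 - xs ! 0)"
    unfolding numeral_2_eq_2 by (rule computable_fun_cong) (auto simp: length_Suc_conv)
qed

lemma computable_fun_if_zero:
  assumes "computable_fun B k F" and "computable_fun B k G" and "computable_fun B k H"
  shows "computable_fun B k (\<lambda>xs. if F xs = 0 then G xs else H xs)"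
proof (rule computable_fun_comp3[OF _ assms])
  have "computable_fun B (Suc (Suc (Suc 0)))
      (\<lambda>xs. rec_nat (tl xs ! 0) (\<lambda>n y. (n # y # tl xs) ! 3) (xs ! 0))"
    by (intro computable_fun_rec computable_fun_nth) simp_all
  moreover have "rec_nat b (\<lambda>n y. c) a = (if a = 0 then b else c)" for a b c :: nat
    by (cases a) simp_all
  ultimately have "computable_fun B (Suc (Suc (Suc 0)))
      (\<lambda>xs. if xs ! 0 = 0 then tl xs ! 0 else tl xs ! Suc 0)"
    by (simp add: numeral_3_eq_3)
  then show "computable_fun B 3 (\<lambda>xs. if xs ! 0 = 0 then xs ! 1 else xs ! 2)"
    unfolding numeral_3_eq_3 by (rule computable_fun_cong) (auto simp: length_Suc_conv)
qed

text \<open>With truncated subtraction, the sum of the two opposite differences vanishes exactly at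
  equality, so a zero test suffices.\<close>

lemma computable_fun_if_eq:
  assumes "computable_fun B k F" and "computable_fun B k G"
    and "computable_fun B k H" and "computable_fun B k I"
  shows "computable_fun B k (\<lambda>xs. if F xs = G xs then H xs else I xs)"
proof -
  have "computable_fun B k (\<lambda>xs. if (F xs - G xs) + (G xs - F xs) = 0 then H xs else I xs)"
    using assms by (intro computable_fun_if_zero computable_fun_add computable_fun_diff)
  moreover have "(F xs - G xs) + (G xs - F xs) = 0 \<longleftrightarrow> F xs = G xs" for xs by auto
  ultimately show ?thesis by simp
qed

section \<open>Computability of the Cantor pairing\<close>

lemma computable_fun_triangle:
  assumes "computable_fun B k F"
  shows "computable_fun B k (\<lambda>xs. triangle (F xs))"
proof (rule computable_fun_comp1[OF _ assms])
  have "computable_fun B (Suc 0)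
      (\<lambda>xs. rec_nat 0 (\<lambda>n y. (n # y # tl xs) ! 1 + Suc ((n # y # tl xs) ! 0)) (xs ! 0))"
    by (intro computable_fun_rec computable_fun_const computable_fun_add computable_fun_Suc
        computable_fun_nth) simp_all
  moreover have "rec_nat 0 (\<lambda>n y. Suc (y + n)) a = triangle a" for a
    by (induction a) simp_all
  ultimately show "computable_fun B 1 (\<lambda>xs. triangle (xs ! 0))" by simp
qed

lemma computable_fun_prod_encode:
  assumes "computable_fun B k F" and "computable_fun B k G"
  shows "computable_fun B k (\<lambda>xs. prod_encode (F xs, G xs))"
  unfolding prod_encode_def using assms
  by (simp add: computable_fun_add computable_fun_triangle)

lemma triangle_mono: "m \<le> n \<Longrightarrow> triangle m \<le> triangle n"
  by (induction rule: dec_induct) simp_all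

text \<open>The code of \<open>(a, b)\<close> is \<open>triangle (a + b) + a\<close> with
  \<open>a\<close> at most \<open>a + b\<close>, so it lies below the next triangular number. Thus a
  search finds the sum of the components.\<close>

lemma Least_triangle_gt:
  "(LEAST t. n < triangle (Suc t)) = fst (prod_decode n) + snd (prod_decode n)"
proof -
  obtain a b where ab: "prod_decode n = (a, b)" by fastforce
  then have "n = prod_encode (a, b)" by (metis prod_decode_inverse)
  then have n: "n = triangle (a + b) + a" by (simp add: prod_encode_def)
  have "(LEAST t. n < triangle (Suc t)) = a + b"
  proof (rule Least_equality)
    show "n < triangle (Suc (a + b))" using n by simp
  next
    fix t
    assume "n < triangle (Suc t)"
    with n have "\<not> triangle (Suc t) \<le> triangle (a + b)" by simp
    then show "a + b \<le> t" using triangle_mono[of "Suc t" "a + b"] by linarith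
  qed
  with ab show ?thesis by simp
qed

lemma computable_fun_sum_prod_decode:
  "computable_fun B 1 (\<lambda>xs. fst (prod_decode (xs ! 0)) + snd (prod_decode (xs ! 0)))"
proof -
  let ?F = "\<lambda>xs. Suc (xs ! 1) - triangle (Suc (xs ! 0))"
  have F: "computable_fun B (Suc 1) ?F"
    by (intro computable_fun_diff computable_fun_triangle computable_fun_Suc computable_fun_nth)
      simp_all
  have ex: "\<exists>n. ?F (n # xs) = 0" for xs
    \<comment> \<open>The search is bounded by the code itself, as \<open>triangle (Suc n)\<close>
      exceeds \<open>n\<close>.\<close>
    by (rule exI[of _ "xs ! 0"]) simp
  have iff: "?F (t # xs) = 0 \<longleftrightarrow> xs ! 0 < triangle (Suc t)" for t xs
    by auto
  show ?thesis
    using computable_fun_Least[OF F ex] unfolding iff Least_triangle_gt .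
qed

lemma computable_fun_fst_prod_decode:
  assumes "computable_fun B k F"
  shows "computable_fun B k (\<lambda>xs. fst (prod_decode (F xs)))"
proof (rule computable_fun_comp1[OF _ assms])
  have *: "n - triangle (fst (prod_decode n) + snd (prod_decode n)) = fst (prod_decode n)" for n
    using prod_decode_inverse[of n] by (simp add: prod_encode_def case_prod_unfold)
  have "computable_fun B 1
     (\<lambda>xs. xs ! 0 - triangle (fst (prod_decode (xs ! 0)) + snd (prod_decode (xs ! 0))))"
    by (intro computable_fun_diff computable_fun_triangle computable_fun_sum_prod_decode
        computable_fun_nth) simp
  then show "computable_fun B 1 (\<lambda>xs. fst (prod_decode (xs ! 0)))"
    unfolding * .
qed

lemma computable_fun_snd_prod_decode:
  assumes "computable_fun B k F"
  shows "computable_fun B k (\<lambda>xs. snd (prod_decode (F xs)))"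
proof (rule computable_fun_comp1[OF _ assms])
  have "computable_fun B 1
     (\<lambda>xs. fst (prod_decode (xs ! 0)) + snd (prod_decode (xs ! 0)) - fst (prod_decode (xs ! 0)))"
    by (intro computable_fun_diff computable_fun_fst_prod_decode computable_fun_sum_prod_decode
        computable_fun_nth) simp
  then show "computable_fun B 1 (\<lambda>xs. snd (prod_decode (xs ! 0)))"
    by simp
qed

section \<open>Computably enumerable sets\<close>

text \<open>The empty oracle always answers 0, so \<open>Zero\<close> can replace every
  query.\<close>

lemma computable_imp_computable_in:
  assumes "computable f"
  shows "computable_in B f"
proof -
  obtain p where p: "\<And>n. eval {} p [n] (f n)"
    using assms unfolding computable_in_def by blast
  have "eval B (subst_oracle Zero p) [n] (f n)" for n
    by (rule eval_subst_oracle[OF _ p]) (simp add: eval_Zero)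
  then show ?thesis
    unfolding computable_in_def by blast
qed

lemma ce_range: "computable f \<Longrightarrow> ce (range f)"
  unfolding ce_def by blast

lemma ce_UNIV: "ce UNIV"
  using ce_range[of "\<lambda>n. n"] by (simp add: computable_in_iff computable_fun_nth)

lemma ce_Un:
  assumes "ce A" and "ce B"
  shows "ce (A \<union> B)"
proof (cases "A = {} \<or> B = {}")
  case True
  with assms show ?thesis by auto
next
  case False
  with assms obtain f g where f: "computable f" "A = range f" and g: "computable g" "B = range g"
    unfolding ce_def by blast
  define h where
    \<comment> \<open>The first component of \<open>n\<close> selects the enumeration, the second is
      the stage in it.\<close>
    "h n = (if fst (prod_decode n) = 0 then f (snd (prod_decode n)) else g (snd (prod_decode n)))"
    for n
  have "computable h"
    unfolding computable_in_iff h_def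
    by (intro computable_fun_if_zero computable_fun_app[OF f(1)] computable_fun_app[OF g(1)]
        computable_fun_fst_prod_decode computable_fun_snd_prod_decode computable_fun_nth) simp_all
  moreover have "range h = A \<union> B"
  proof
    show "range h \<subseteq> A \<union> B" by (auto simp: h_def f(2) g(2))
    have "f n = h (prod_encode (0, n))" and "g n = h (prod_encode (1, n))" for n
      by (simp_all add: h_def)
    then show "A \<union> B \<subseteq> range h" by (auto simp: f(2) g(2))
  qed
  ultimately show ?thesis using ce_range by metis
qed

lemma ce_Times:
  assumes "ce A" and "ce B"
  shows "ce (prod_encode ` (A \<times> B))"
proof (cases "A = {} \<or> B = {}")
  case True
  then show ?thesis unfolding ce_def by auto
next
  case False
  with assms obtain f g where f: "computable f" "A = range f" and g: "computable g" "B = range g"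
    unfolding ce_def by blast
  define h where "h n = prod_encode (f (fst (prod_decode n)), g (snd (prod_decode n)))" for n
  have "computable h"
    unfolding computable_in_iff h_def
    by (intro computable_fun_prod_encode computable_fun_app[OF f(1)] computable_fun_app[OF g(1)]
        computable_fun_fst_prod_decode computable_fun_snd_prod_decode computable_fun_nth) simp_all
  moreover have "range h = prod_encode ` (A \<times> B)"
  proof
    show "range h \<subseteq> prod_encode ` (A \<times> B)" by (auto simp: h_def f(2) g(2))
    have "prod_encode (f m, g n) = h (prod_encode (m, n))" for m n
      by (simp add: h_def)
    then show "prod_encode ` (A \<times> B) \<subseteq> range h" by (auto simp: f(2) g(2))
  qed
  ultimately show ?thesis using ce_range by metis
qed

section \<open>Reductions to an oracle\<close>

lemma turing_reducible_vimage:
  assumes "computable f" and "A \<le>\<^sub>T B"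
  shows "f -` A \<le>\<^sub>T B"
  using computable_fun_app[OF assms(2)[unfolded turing_reducible_def]]
    computable_imp_computable_in[OF assms(1), of B]
  unfolding turing_reducible_def computable_in_iff by simp

text \<open>One search suffices: it stops either at an enumeration of \<open>x\<close> into \<open>A\<close> or at a witness
  \<open>u \<in> U\<close> for \<open>x \<notin> A\<close>.\<close>

lemma turing_reducible_if_complement_enumerable:
  assumes "ce A" and "ce U" and X: "X \<le>\<^sub>T B"
    and compl: "\<And>x. x \<notin> A \<longleftrightarrow> (\<exists>u\<in>U. prod_encode (x, u) \<notin> X)"
  shows "A \<le>\<^sub>T B"
proof (cases "A = {} \<or> U = {}")
  case True
  \<comment> \<open>An empty \<open>U\<close> has no witnesses, so \<open>compl\<close> leaves
    nothing outside \<open>A\<close>.\<close>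
  then have "A = {} \<or> A = UNIV" using compl by auto
  then show ?thesis
    unfolding turing_reducible_def computable_in_iff by (auto simp: computable_fun_const)
next
  case False
  with assms obtain f g where "computable f" and A: "A = range f"
    and "computable g" and U: "U = range g"
    unfolding ce_def by blast
  then have f: "computable_in B f" and g: "computable_in B g"
    by (simp_all add: computable_imp_computable_in)
  \<comment> \<open>The stage searched for is entry 0, the input is entry 1. A zero marks either of
    the two reasons to stop.\<close>
  define F where "F xs =
    (if f (xs ! 0) = xs ! 1 then 0 else of_bool (prod_encode (xs ! 1, g (xs ! 0)) \<in> X) :: nat)" for xs
  define s where "s x = (LEAST n. F [n, x] = 0)" for x
  have F: "computable_fun B (Suc 1) F"
    unfolding F_def
    by (intro computable_fun_if_eq computable_fun_const computable_fun_app[OF f]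
        computable_fun_app[OF g] computable_fun_app[OF X[unfolded turing_reducible_def]]
        computable_fun_prod_encode computable_fun_nth) simp_all
  have ex: "\<exists>n. F [n, x] = 0" for x
  proof (cases "x \<in> A")
    case True
    then show ?thesis by (auto simp: A F_def)
  next
    case False
    then show ?thesis using compl[of x] by (auto simp: U F_def)
  qed
  then have s: "F [s x, x] = 0" for x
    unfolding s_def by (rule LeastI_ex)
  \<comment> \<open>For \<open>x\<close> in \<open>A\<close>, \<open>compl\<close> rules out the
    second reason to stop, so checking \<open>f\<close> at the stopping stage decides
    membership.\<close>
  have mem: "x \<in> A \<longleftrightarrow> f (s x) = x" for x
  proof
    assume "f (s x) = x"
    then show "x \<in> A" using A by (metis rangeI)
  next
    assume "x \<in> A"
    then show "f (s x) = x"
      using s[of x] compl[of x] by (auto simp: F_def U split: if_splits)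
  qed
  have "computable_fun B 1 (\<lambda>xs. LEAST n. F (n # xs) = 0)"
    by (rule computable_fun_Least[OF F]) (use ex in \<open>auto simp: length_Suc_conv\<close>)
  then have "computable_fun B 1 (\<lambda>xs. s (xs ! 0))"
    unfolding s_def by (rule computable_fun_cong) (auto simp: length_Suc_conv)
  then have "computable_fun B 1 (\<lambda>xs. if f (s (xs ! 0)) = xs ! 0 then 1 else 0)"
    by (intro computable_fun_if_eq computable_fun_const computable_fun_app[OF f]
        computable_fun_nth) simp_all
  then show ?thesis
    unfolding turing_reducible_def computable_in_iff mem by (simp add: of_bool_def)
qed

section \<open>Intervals of computably enumerable sets\<close>

text \<open>This is the induction step of the theorem: it adds one disjunct to any nested c.e. pair
  and again yields such a pair.\<close>

lemma interval_disjunction: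
  assumes A: "ce A" and U: "ce U" and V: "ce V" and UV: "U \<subseteq> V"
  shows "\<exists>U' V'. ce U' \<and> ce V' \<and> U' \<subseteq> V' \<and>
    (\<forall>B. (\<exists>X. X \<le>\<^sub>T B \<and> U' \<subseteq> X \<and> X \<subseteq> V') \<longleftrightarrow> A \<le>\<^sub>T B \<or> (\<exists>X. X \<le>\<^sub>T B \<and> U \<subseteq> X \<and> X \<subseteq> V))"
proof (rule exI, rule exI, intro conjI allI iffI)
  let ?U = "prod_encode ` (A \<times> U)" and ?V = "prod_encode ` (A \<times> UNIV) \<union> prod_encode ` (UNIV \<times> V)"
  show "ce ?U" using A U by (rule ce_Times)
  show "ce ?V" using A V by (intro ce_Un ce_Times ce_UNIV)
  show "?U \<subseteq> ?V" by auto
  show "A \<le>\<^sub>T B \<or> (\<exists>X. X \<le>\<^sub>T B \<and> U \<subseteq> X \<and> X \<subseteq> V)"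
    if ex: "\<exists>X. X \<le>\<^sub>T B \<and> ?U \<subseteq> X \<and> X \<subseteq> ?V" for B
  proof -
    from ex obtain X where X: "X \<le>\<^sub>T B" "?U \<subseteq> X" "X \<subseteq> ?V" by blast
    show ?thesis
    proof (cases "\<forall>x. x \<notin> A \<longrightarrow> (\<exists>u\<in>U. prod_encode (x, u) \<notin> X)")
      case True
      \<comment> \<open>The converse direction holds because \<open>X\<close> contains the code of
        every pair in \<open>A \<times> U\<close>.\<close>
      with X(2) have "x \<notin> A \<longleftrightarrow> (\<exists>u\<in>U. prod_encode (x, u) \<notin> X)" for x by blast
      with A U X(1) have "A \<le>\<^sub>T B" by (rule turing_reducible_if_complement_enumerable)
      then show ?thesis ..
    next
      case False
      then obtain x where x: "x \<notin> A" "\<And>u. u \<in> U \<Longrightarrow> prod_encode (x, u) \<in> X" by blast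
      let ?Y = "(\<lambda>u. prod_encode (x, u)) -` X"
      have "computable (\<lambda>u. prod_encode (x, u))"
        unfolding computable_in_iff
        by (intro computable_fun_prod_encode computable_fun_const computable_fun_nth) simp
      then have "?Y \<le>\<^sub>T B" using X(1) by (rule turing_reducible_vimage)
      moreover have "U \<subseteq> ?Y" using x(2) by blast
      \<comment> \<open>As \<open>x\<close> is outside \<open>A\<close>, a pair
        \<open>(x, u)\<close> can be coded in \<open>?V\<close> only through \<open>u\<close> in
        \<open>V\<close>.\<close>
      moreover have "?Y \<subseteq> V" using X(3) x(1) by auto
      ultimately show ?thesis by blast
    qed
  qed
  show "\<exists>X. X \<le>\<^sub>T B \<and> ?U \<subseteq> X \<and> X \<subseteq> ?V"
    if disj: "A \<le>\<^sub>T B \<or> (\<exists>X. X \<le>\<^sub>T B \<and> U \<subseteq> X \<and> X \<subseteq> V)" for B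
  proof -
    have fst: "computable (\<lambda>n. fst (prod_decode n))" and snd: "computable (\<lambda>n. snd (prod_decode n))"
      unfolding computable_in_iff
      by (intro computable_fun_fst_prod_decode computable_fun_snd_prod_decode computable_fun_nth; simp)+
    from disj show ?thesis
    proof (elim disjE exE conjE)
      let ?X = "(\<lambda>n. fst (prod_decode n)) -` A"
      assume "A \<le>\<^sub>T B"
      then have "?X \<le>\<^sub>T B" by (rule turing_reducible_vimage[OF fst])
      moreover have "?U \<subseteq> ?X" by auto
      moreover have "?X \<subseteq> ?V"
        \<comment> \<open>Every number codes the pair of its components, so \<open>?X\<close> falls
          into the first part of \<open>?V\<close>.\<close>
        by (rule subsetI) (metis UNIV_I UnI1 SigmaI imageI prod.collapse prod_decode_inverse vimageD)
      ultimately show ?thesis by blast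
    next
      fix X
      let ?X = "(\<lambda>n. snd (prod_decode n)) -` X"
      assume X: "X \<le>\<^sub>T B" "U \<subseteq> X" "X \<subseteq> V"
      have "?X \<le>\<^sub>T B" using X(1) by (rule turing_reducible_vimage[OF snd])
      moreover have "?U \<subseteq> ?X" using X(2) by auto
      moreover have "?X \<subseteq> ?V"
        using X(3)
        by (intro subsetI) (metis UNIV_I UnI2 SigmaI imageI prod.collapse prod_decode_inverse
            vimageD subsetD)
      ultimately show ?thesis by blast
    qed
  qed
qed

section \<open>From sets to degrees\<close>

lemma degree_of_le_iff: "degree_of A \<le> degree_of B \<longleftrightarrow> A \<le>\<^sub>T B"
  by (rule less_eq_turing_degree.abs_eq)

text \<open>The choice of representative is immaterial: \<open>X \<le>\<^sub>T B\<close> compares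
  the degrees of \<open>X\<close> and \<open>B\<close>.\<close>

lemma degree_computable_degree_of: "degree_computable (degree_of B) X \<longleftrightarrow> X \<le>\<^sub>T B"
  unfolding degree_computable_def by (metis degree_of_le_iff)

theorem theorem3:
  fixes ds :: "turing_degree list"
  assumes "ds \<noteq> []" and "\<forall>a\<in>set ds. ce_degree a"
  shows "\<exists>U V. ce U \<and> ce V \<and> U \<subseteq> V \<and>
    (\<forall>x. (\<exists>X. degree_computable x X \<and> U \<subseteq> X \<and> X \<subseteq> V) \<longleftrightarrow> (\<exists>a\<in>set ds. a \<le> x))"
proof -
  \<comment> \<open>The induction quantifies over oracle sets \<open>B\<close> instead of degrees,
    matching \<open>interval_disjunction\<close>.\<close>
  have "\<exists>U V. ce U \<and> ce V \<and> U \<subseteq> V \<and>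
    (\<forall>B. (\<exists>X. X \<le>\<^sub>T B \<and> U \<subseteq> X \<and> X \<subseteq> V) \<longleftrightarrow> (\<exists>a\<in>set ds. a \<le> degree_of B))"
    using assms
  proof (induction ds rule: list_nonempty_induct)
    case (single a)
    then obtain A where A: "ce A" "a = degree_of A" by (auto simp: ce_degree_def)
    have "(\<exists>X. X \<le>\<^sub>T B \<and> A \<subseteq> X \<and> X \<subseteq> A) \<longleftrightarrow> A \<le>\<^sub>T B" for B
      by (metis order_refl subset_antisym)
    with A show ?case
      by (intro exI[of _ A]) (simp add: degree_of_le_iff)
  next
    case (cons a ds)
    then obtain A where A: "ce A" "a = degree_of A" by (auto simp: ce_degree_def)
    from cons obtain U V where UV: "ce U" "ce V" "U \<subseteq> V"
      and iff: "\<And>B. (\<exists>X. X \<le>\<^sub>T B \<and> U \<subseteq> X \<and> X \<subseteq> V) \<longleftrightarrow> (\<exists>a\<in>set ds. a \<le> degree_of B)"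
      by auto
    from interval_disjunction[OF A(1) UV] show ?case
      unfolding iff by (simp add: A(2) degree_of_le_iff)
  qed
  \<comment> \<open>Every degree is the degree of some set, which carries the result back to all
    degrees.\<close>
  moreover have "(\<forall>x. P x) \<longleftrightarrow> (\<forall>B. P (degree_of B))" for P
    by (metis Quotient3_turing_degree Quotient3_abs_rep)
  ultimately show ?thesis
    by (simp add: degree_computable_degree_of)
qed

end
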